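(* For all $(\lambda,\mu)\in G$, the set $\partial_{top}(A_{\lambda,\mu})$ is the graph of a continuous, strictly increasing function.
   Context: Throughout, $0<\lambda<\mu<1$ and $\lambda+\mu>1$. Define maps of the plane $$T_0(x,y)=(\lambda x,\mu y),\qquad T_1(x,y)=(\mu x+1-\mu,\ \lambda y+1-\lambda),$$ and let $A_{\lambda,\mu}$ be the attractor of the iterated function system $\{T_0,T_1\}$, i.e. the unique non-empty compact set $A\subset\mathbb{R}^2$ with $A=T_0(A)\cup T_1(A)$; one has $A_{\lambda,\mu}\subset[0,1]\times[0,1]$. Its top is $$\partial_{top}(A_{\lambda,\mu})=\{(x,y)\in A_{\lambda,\mu} : \text{for all } y' \text{ with } (x,y')\in A_{\lambda,\mu} \text{ we have } y'\le y\}.$$ Define further the (not necessarily continuous) maps $$S_0(x,y)=\begin{cases}T_0(x,y), & \lambda x+\mu y\le 1,\\ (0,0), & \text{otherwise,}\end{cases}\qquad S_1(x,y)=\begin{cases}T_1(x,y), & \mu x+\lambda y\ge \lambda+\mu-1,\\ (1,1), & \text{otherwise.}\end{cases}$$ An attractor of $\{S_0,S_1\}$ is a non-empty compact set $B$ with $B=S_0(B)\cup S_1(B)$. Attractors are not unique, all of them are contained in $[0,1]\times[0,1]$, and there is a maximal one (with respect to inclusion), denoted $B_{\lambda,\mu}$. A point $(a,b)$ with $a\in[0,1]$ is said to be below $B_{\lambda,\mu}$ if there is $y\ge b$ with $(a,y)\in B_{\lambda,\mu}$. The set $G$ is $$G=\{(\lambda,\mu): 0<\lambda<\mu<1,\ \lambda+\mu>1,\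 T_0(1,1)\text{ and }T_1(0,0)\text{ are below } B_{\lambda,\mu}\}.$$ Here $T_0(1,1)=(\lambda,\mu)$ and $T_1(0,0)=(1-\mu,1-\lambda)$. *)

theory Defs
  imports "HOL-Analysis.Analysis"
begin

fun T0 :: "real \<Rightarrow> real \<Rightarrow> real \<times> real \<Rightarrow> real \<times> real" where
  "T0 l m (x, y) = (l * x, m * y)"

fun T1 :: "real \<Rightarrow> real \<Rightarrow> real \<times> real \<Rightarrow> real \<times> real" where
  "T1 l m (x, y) = (m * x + 1 - m, l * y + 1 - l)"

fun S0 :: "real \<Rightarrow> real \<Rightarrow> real \<times> real \<Rightarrow> real \<times> real" where
  "S0 l m (x, y) = (if l * x + m * y \<le> 1 then T0 l m (x, y) else (0, 0))"

fun S1 :: "real \<Rightarrow> real \<Rightarrow> real \<times> real \<Rightarrow> real \<times> real" where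
  "S1 l m (x, y) = (if m * x + l * y \<ge> l + m - 1 then T1 l m (x, y) else (1, 1))"

definition is_attractor ::
  "(real \<times> real \<Rightarrow> real \<times> real) \<Rightarrow> (real \<times> real \<Rightarrow> real \<times> real) \<Rightarrow> (real \<times> real) set \<Rightarrow> bool"
  where "is_attractor f g K \<longleftrightarrow> K \<noteq> {} \<and> compact K \<and> K = f ` K \<union> g ` K"

definition attractor_A :: "real \<Rightarrow> real \<Rightarrow> (real \<times> real) set" where
  "attractor_A l m = (THE A. is_attractor (T0 l m) (T1 l m) A)"

(* The order is inclusion.  For 0 < l < m < 1 < l + m the system {S0, S1} has
   a greatest attractor, which is therefore also its only maximal one: it is the
   intersection of the iterates of the unit square under K |-> S0 ` K \<union> S1 ` K. *)
definition attractor_B :: "real \<Rightarrow> real \<Rightarrow> (real \<times> real) set" where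
  "attractor_B l m = (GREATEST B. is_attractor (S0 l m) (S1 l m) B)"

definition top_boundary :: "(real \<times> real) set \<Rightarrow> (real \<times> real) set" where
  "top_boundary K = {(x, y). (x, y) \<in> K \<and> (\<forall>y'. (x, y') \<in> K \<longrightarrow> y' \<le> y)}"

fun is_below :: "real \<times> real \<Rightarrow> (real \<times> real) set \<Rightarrow> bool" where
  "is_below (a, b) K \<longleftrightarrow> a \<in> {0..1} \<and> (\<exists>y\<ge>b. (a, y) \<in> K)"

definition G :: "(real \<times> real) set" where
  "G = {(l, m). 0 < l \<and> l < m \<and> m < 1 \<and> l + m > 1 \<and>
         is_below (T0 l m (1, 1)) (attractor_B l m) \<and>
         is_below (T1 l m (0, 0)) (attractor_B l m)}"

end

theory Submission
  imports Defs
begin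

text \<open>Let \<open>f x\<close> be the largest \<open>y\<close> with \<open>(x, y) \<in> A\<close>. Self-similarity of \<open>A\<close> makes \<open>f\<close> the maximum of
  the branches \<open>g\<^sub>0 x = m f(x / l)\<close> on \<open>[0, l]\<close> and \<open>g\<^sub>1 x = l f((x - 1 + m) / m) + 1 - l\<close> on
  \<open>[1 - m, 1]\<close>. As \<open>B \<subseteq> A\<close>, and points of \<open>B\<close> above (below) the antidiagonal come from \<open>T\<^sub>1\<close> (\<open>T\<^sub>0\<close>),
  membership in \<open>G\<close> gives \<open>g\<^sub>1 \<ge> g\<^sub>0\<close> at \<open>l\<close> and \<open>g\<^sub>0 \<ge> g\<^sub>1\<close> at \<open>1 - m\<close>: where one branch ends, the
  other one dominates. Then the defect of monotonicity, \<open>sup {f x - f x' | x \<le> x'}\<close>, is at most \<open>m\<close>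
  times itself, hence zero; the oscillation of \<open>f\<close> at small scales contracts in the same way; and an
  interval of constancy of \<open>f\<close> would produce another one longer by a factor \<open>1 / m\<close>, and so on,
  which is impossible inside \<open>[0, 1]\<close>.\<close>

section \<open>Attractors of a pair of maps\<close>

text \<open>Every point of \<open>K\<close> has a predecessor in \<open>K\<close> under
  \<open>f\<close> or \<open>g\<close>, and passing from the predecessor to the point shrinks the
  bound on the distance to \<open>L\<close> by the factor \<open>c\<close>. After \<open>n\<close>
  such steps the bound is \<open>c ^ n * D\<close>, so the distance is zero, and \<open>L\<close> is
  closed.\<close>

lemma sub_self_image_subset_invariant:
  fixes f g :: "'a :: metric_space \<Rightarrow> 'a"
  assumes lip: "c-lipschitz_on UNIV f" "c-lipschitz_on UNIV g" "c < 1"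
    and K: "bounded K" "K \<subseteq> f ` K \<union> g ` K"
    and L: "closed L" "L \<noteq> {}" "f ` L \<union> g ` L \<subseteq> L"
  shows "K \<subseteq> L"
proof
  fix p assume p: "p \<in> K"
  have c: "0 \<le> c" using lip(1) by (rule lipschitz_on_nonneg)
  obtain z where z: "z \<in> L" using L(2) by blast
  obtain D where D: "\<And>q. q \<in> K \<Longrightarrow> dist q z \<le> D"
    using K(1) by (auto simp: bounded_any_center[where a = z] dist_commute)
  have approx: "\<forall>q\<in>K. \<exists>r\<in>L. dist q r \<le> c ^ n * D" for n
  proof (induction n)
    case 0
    then show ?case using D z by auto
  next
    case (Suc n)
    have step: "\<exists>r\<in>L. dist (h q) r \<le> c ^ Suc n * D"
      if q: "q \<in> K" and h: "c-lipschitz_on UNIV h" "h ` L \<subseteq> L" for q h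
    proof -
      obtain r where r: "r \<in> L" "dist q r \<le> c ^ n * D" using Suc q by blast
      have "dist (h q) (h r) \<le> c * dist q r" using h(1) by (rule lipschitz_onD) auto
      also have "\<dots> \<le> c * (c ^ n * D)" using r(2) c by (rule mult_left_mono)
      finally show ?thesis using r(1) h(2) by (auto simp: mult.assoc)
    qed
    show ?case
    proof
      fix q assume "q \<in> K"
      then obtain q' where "q' \<in> K" "q = f q' \<or> q = g q'" using K(2) by blast
      then show "\<exists>r\<in>L. dist q r \<le> c ^ Suc n * D" using step lip(1,2) L(3) by auto
    qed
  qed
  have lim: "(\<lambda>n. c ^ n * D) \<longlonglongrightarrow> 0"
    using c lip(3) by (intro tendsto_mult_left_zero LIMSEQ_power_zero) auto
  have "\<exists>r. r \<in> L \<and> dist p r \<le> c ^ n * D" for n using approx p by blast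
  then obtain r where r: "\<And>n. r n \<in> L" "\<And>n. dist p (r n) \<le> c ^ n * D" by metis
  have "r \<longlonglongrightarrow> p"
    by (rule metric_tendsto_imp_tendsto[OF lim])
      (use r(2) in \<open>auto simp: dist_commute intro!: always_eventually order_trans[OF _ abs_ge_self]\<close>)
  then show "p \<in> L" using L(1) r(1) closed_sequentially by blast
qed

lemma is_attractorD:
  assumes "is_attractor f g K"
  shows "K \<noteq> {}" "bounded K" "closed K" "compact K"
    "K \<subseteq> f ` K \<union> g ` K" "f ` K \<union> g ` K \<subseteq> K"
  using assms unfolding is_attractor_def by (blast intro: compact_imp_bounded compact_imp_closed)+

lemma greatest_attractor_exists:
  assumes Q: "compact Q" "f ` Q \<union> g ` Q \<subseteq> Q"
    and P: "P \<noteq> {}" "P \<subseteq> Q" "P \<subseteq> f ` P \<union> g ` P"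
    and cl: "\<And>K. compact K \<Longrightarrow> P \<subseteq> K \<Longrightarrow> K \<subseteq> Q \<Longrightarrow> closed (f ` K \<union> g ` K)"
  obtains K where "is_attractor f g K" "\<And>L. L \<subseteq> Q \<Longrightarrow> L \<subseteq> f ` L \<union> g ` L \<Longrightarrow> L \<subseteq> K"
proof
  define K where "K = \<Union>{L. L \<subseteq> Q \<and> L \<subseteq> f ` L \<union> g ` L}"
  show greatest: "L \<subseteq> K" if "L \<subseteq> Q" "L \<subseteq> f ` L \<union> g ` L" for L
    using that unfolding K_def by blast
  have sub: "K \<subseteq> f ` K \<union> g ` K" "K \<subseteq> Q" unfolding K_def by blast+
  have PK: "P \<subseteq> K" using P by (intro greatest) auto
  have "f ` K \<union> g ` K \<subseteq> K" using sub Q(2) by (intro greatest) blast+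
  with sub have fix_K: "K = f ` K \<union> g ` K" by blast
  have clQ: "closure K \<subseteq> Q" using sub(2) Q(1) by (intro closure_minimal compact_imp_closed)
  have comp: "compact (closure K)" using sub(2) Q(1) by (metis bounded_subset compact_closure compact_imp_bounded)
  have "closed (f ` closure K \<union> g ` closure K)"
    using comp clQ PK closure_subset[of K] by (intro cl) auto
  then have "closure K \<subseteq> f ` closure K \<union> g ` closure K"
    using sub(1) closure_subset[of K] by (intro closure_minimal) blast+
  then have "closure K \<subseteq> K" using clQ by (intro greatest)
  then have "compact K" using comp closure_subset[of K] by (metis subset_antisym)
  then show "is_attractor f g K" using fix_K PK P(1) unfolding is_attractor_def by blast
qed

section \<open>The functional equation of the top function, and monotonicity\<close>

text \<open>\<open>ge0\<close>, \<open>ge1\<close> and \<open>branches\<close> together say that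
  \<open>f\<close> is the maximum of its two branches. \<open>right_end\<close> compares them at
  \<open>l\<close>, where the first branch has the value \<open>m * f 1 = m\<close>;
  \<open>left_end\<close> compares them at \<open>1 - m\<close>, where the second has the value
  \<open>1 - l\<close>.\<close>

locale top_function =
  fixes l m :: real and f :: "real \<Rightarrow> real"
  assumes lm: "0 < l" "l < m" "m < 1" "1 < l + m"
    and f01: "x \<in> {0..1} \<Longrightarrow> f x \<in> {0..1}"
    and f0: "f 0 = 0" and f1: "f 1 = 1"
    and ge0: "x \<in> {0..1} \<Longrightarrow> m * f x \<le> f (l * x)"
    and ge1: "x \<in> {0..1} \<Longrightarrow> l * f x + 1 - l \<le> f (m * x + 1 - m)"
    and branches: "x \<in> {0..1} \<Longrightarrow> (\<exists>u\<in>{0..1}. x = l * u \<and> f x = m * f u) \<or>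
        (\<exists>u\<in>{0..1}. x = m * u + 1 - m \<and> f x = l * f u + 1 - l)"
    and right_end: "\<exists>u\<in>{0..1}. l = m * u + 1 - m \<and> m \<le> l * f u + 1 - l"
    and left_end: "\<exists>u\<in>{0..1}. 1 - m = l * u \<and> 1 - l \<le> m * f u"
begin

lemma ex_branch0: "\<exists>u\<in>{0..1}. x = l * u" if "0 \<le> x" "x \<le> l"
  using that lm by (intro bexI[of _ "x / l"]) auto

lemma ex_branch1: "\<exists>u\<in>{0..1}. x = m * u + 1 - m" if "1 - m \<le> x" "x \<le> 1"
  using that lm by (intro bexI[of _ "(x - 1 + m) / m"]) (auto simp: field_simps)

lemma f_diff_le_1: "f x - f x' \<le> 1" if "x \<in> {0..1}" "x' \<in> {0..1}"
  using f01[OF that(1)] f01[OF that(2)] by auto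

lemma monotone_approx:
  "\<forall>x\<in>{0..1}. \<forall>x'\<in>{0..1}. x \<le> x' \<longrightarrow> f x - f x' \<le> m ^ n"
proof (induction n)
  case 0
  show ?case using f_diff_le_1 by simp
next
  case (Suc n)
  have ord: "l * m ^ n \<le> m ^ Suc n" using lm by simp
  show ?case
  proof (intro ballI impI)
    fix x x' :: real
    assume x: "x \<in> {0..1}" and x': "x' \<in> {0..1}" and le: "x \<le> x'"
    from branches[OF x] show "f x - f x' \<le> m ^ Suc n"
    proof (elim disjE bexE conjE)
      fix u assume u: "u \<in> {0..1}" "x = l * u" "f x = m * f u"
      show ?thesis
      proof (cases "x' \<le> l")
        case True
        then obtain u' where u': "u' \<in> {0..1}" "x' = l * u'" using ex_branch0 x' by force
        have "f u - f u' \<le> m ^ n" using Suc u u' le lm by auto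
        then have "m * (f u - f u') \<le> m ^ Suc n" using lm by simp
        then show ?thesis using ge0[OF u'(1)] u u' by (simp add: algebra_simps)
      next
        case False
        then obtain u' where u': "u' \<in> {0..1}" "x' = m * u' + 1 - m"
          using ex_branch1[of x'] x' lm by auto
        \<comment> \<open>Here \<open>x\<close> and \<open>x'\<close> lie on different sides of
          \<open>l\<close>, and \<open>l\<close> serves as an intermediate point: \<open>f x\<close>
          is at most \<open>m\<close>, hence at most the second branch at \<open>l\<close>, and from
          \<open>l\<close> to \<open>x'\<close> the second branch is controlled by the induction
          hypothesis at \<open>p\<close> and \<open>u'\<close>.\<close>
        obtain p where p: "p \<in> {0..1}" "l = m * p + 1 - m" "m \<le> l * f p + 1 - l"
          using right_end by blast
        have "m * p \<le> m * u'" using False p u' by linarith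
        then have "p \<le> u'" using lm by simp
        then have "f p - f u' \<le> m ^ n" using Suc p u' by blast
        then have "l * (f p - f u') \<le> l * m ^ n" using lm by simp
        moreover have "m * f u \<le> m" using f01[OF u(1)] lm by simp
        ultimately show ?thesis
          using ge1[OF u'(1), folded u'(2)] u(3) p(3) ord unfolding right_diff_distrib by linarith
      qed
    next
      fix u assume u: "u \<in> {0..1}" "x = m * u + 1 - m" "f x = l * f u + 1 - l"
      have "1 - m \<le> x" using u lm by simp
      then obtain u' where u': "u' \<in> {0..1}" "x' = m * u' + 1 - m"
        using ex_branch1[of x'] x' le by auto
      have "f u - f u' \<le> m ^ n" using Suc u u' le lm by auto
      then have "l * (f u - f u') \<le> l * m ^ n" using lm by simp
      then show ?thesis
        using ge1[OF u'(1), folded u'(2)] u(3) ord unfolding right_diff_distrib by linarith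
    qed
  qed
qed

lemma f_mono: "f x \<le> f x'" if "x \<in> {0..1}" "x' \<in> {0..1}" "x \<le> x'"
proof -
  have "(\<lambda>n. m ^ n) \<longlonglongrightarrow> 0" using lm by (intro LIMSEQ_power_zero) auto
  then have "f x - f x' \<le> 0"
    by (rule LIMSEQ_le_const) (use monotone_approx that in blast)
  then show ?thesis by simp
qed

section \<open>Continuity of the top function\<close>

lemma branch0_near_0: "f (l * u) = m * f u" if "u \<in> {0..1}" "l * u < 1 - m"
proof -
  have "l * u \<in> {0..1}" using that lm by (auto simp: mult_le_one)
  from branches[OF this] show ?thesis using that lm by (auto simp: mult_less_0_iff)
qed

text \<open>Continuity at 0: left of \<open>1 - m\<close> only the first branch exists, so shrinking
  the argument by \<open>l\<close> multiplies the value by \<open>m\<close>. This controls the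
  second branch just after it starts.\<close>

lemma small_near_0: "\<exists>d>0. \<forall>t\<in>{0..1}. t < d \<longrightarrow> f t \<le> m ^ n"
proof (induction n)
  case 0
  show ?case using f01 by (intro exI[of _ 1]) auto
next
  case (Suc n)
  then obtain d where d: "d > 0" "\<And>t. t \<in> {0..1} \<Longrightarrow> t < d \<Longrightarrow> f t \<le> m ^ n" by blast
  have "f t \<le> m ^ Suc n" if t: "t \<in> {0..1}" "t < min (l * d) (1 - m)" for t
  proof -
    have "t \<le> l" using t lm by auto
    then obtain u where u: "u \<in> {0..1}" "t = l * u" using ex_branch0 t by force
    have "u < d" using t u lm by auto
    then have "f u \<le> m ^ n" using d u by blast
    then show ?thesis using branch0_near_0[OF u(1)] t u lm by auto
  qed
  then show ?case using d lm by (intro exI[of _ "min (l * d) (1 - m)"]) auto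
qed

text \<open>One step contracts the oscillation by \<open>m\<close>, except that a pair of points
  separated by \<open>1 - m\<close> adds an error. The rate \<open>(1 + m) / 2\<close>, midway
  between \<open>m\<close> and 1, leaves room for it.\<close>

lemma modulus_approx:
  "\<exists>d>0. \<forall>x\<in>{0..1}. \<forall>x'\<in>{0..1}. x \<le> x' \<longrightarrow> x' < x + d \<longrightarrow> f x' - f x \<le> ((1 + m) / 2) ^ n"
proof (induction n)
  case 0
  show ?case using f_diff_le_1 by (intro exI[of _ 1]) simp
next
  case (Suc n)
  define c where "c = ((1 + m) / 2) ^ n"
  have c: "c > 0" using lm by (simp add: c_def)
  obtain d where d: "d > 0"
    "\<And>x x'. x \<in> {0..1} \<Longrightarrow> x' \<in> {0..1} \<Longrightarrow> x \<le> x' \<Longrightarrow> x' < x + d \<Longrightarrow> f x' - f x \<le> c"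
    using Suc unfolding c_def by blast
  have cS: "((1 + m) / 2) ^ Suc n = m * c + (1 - m) / 2 * c" by (simp add: c_def field_simps)
  have e: "(1 - m) / 2 * c > 0" using c lm by simp
  \<comment> \<open>\<open>N\<close> makes the error at the crossing smaller than the slack
    \<open>(1 - m) / 2 * c\<close>.\<close>
  obtain N where N: "m ^ N < (1 - m) / 2 * c" using real_arch_pow_inv[OF e lm(3)] by blast
  obtain r where r: "r > 0" "\<And>t. t \<in> {0..1} \<Longrightarrow> t < r \<Longrightarrow> f t \<le> m ^ N"
    using small_near_0 by blast
  have lc: "l * c \<le> m * c" using lm c by simp
  \<comment> \<open>The bound \<open>l * d\<close> keeps preimages under either branch within
    \<open>d\<close>, since \<open>l < m\<close>; the bound \<open>m * r\<close> puts the
    second-branch preimage of \<open>x'\<close> below \<open>r\<close> if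
    \<open>x < 1 - m\<close>.\<close>
  have "f x' - f x \<le> ((1 + m) / 2) ^ Suc n"
    if x: "x \<in> {0..1}" "x' \<in> {0..1}" "x \<le> x'" "x' < x + min (l * d) (m * r)" for x x'
  proof -
    have close: "x' < x + l * d" "x' < x + m * d"
      using x(4) mult_strict_right_mono[OF lm(2) d(1)] by auto
    from branches[OF x(2)] show ?thesis
    proof (elim disjE bexE conjE)
      fix u' assume u': "u' \<in> {0..1}" "x' = l * u'" "f x' = m * f u'"
      have "l * u' \<le> l" using u' lm by simp
      then obtain u where u: "u \<in> {0..1}" "x = l * u" using ex_branch0[of x] x u' by auto
      have "l * u' < l * (u + d)" using close u u' by (simp add: algebra_simps)
      then have "u' < u + d" using lm by simp
      then have "f u' - f u \<le> c" using d u u' x lm by simp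
      then have "m * (f u' - f u) \<le> m * c" using lm by simp
      then show ?thesis using ge0[OF u(1)] u u' e cS unfolding right_diff_distrib by simp
    next
      fix u' assume u': "u' \<in> {0..1}" "x' = m * u' + 1 - m" "f x' = l * f u' + 1 - l"
      show ?thesis
      proof (cases "1 - m \<le> x")
        case True
        then obtain u where u: "u \<in> {0..1}" "x = m * u + 1 - m" using ex_branch1[of x] x by auto
        have "m * u' < m * (u + d)" using close u u' by (simp add: algebra_simps)
        then have "u' < u + d" using lm by simp
        then have "f u' - f u \<le> c" using d u u' x lm by simp
        then have "l * (f u' - f u) \<le> l * c" using lm by simp
        then show ?thesis using ge1[OF u(1)] u u' e lc cS unfolding right_diff_distrib by simp
      next
        case False
        then obtain u where u: "u \<in> {0..1}" "x = l * u" using ex_branch0[of x] x lm by auto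
        \<comment> \<open>The crossing of \<open>1 - m\<close>, whose first-branch preimage is
          \<open>p\<close>: by \<open>left_end\<close> the starting height \<open>1 - l\<close> of
          the second branch is at most \<open>m * f p\<close>, which exceeds \<open>m * f u\<close>
          by at most \<open>m * c\<close>; the remaining term \<open>l * f u'\<close> fits into the
          slack.\<close>
        obtain p where p: "p \<in> {0..1}" "1 - m = l * p" "1 - l \<le> m * f p" using left_end by blast
        have "0 \<le> m * u'" using u' lm by simp
        then have "l * p < l * (u + d)" using close u u' p unfolding distrib_left by linarith
        then have "p < u + d" using lm by simp
        moreover have "l * u \<le> l * p" using False u p by linarith
        then have "u \<le> p" using lm by simp
        ultimately have "f p - f u \<le> c" using d u p by blast
        then have "m * (f p - f u) \<le> m * c" using lm by simp
        moreover have "m * u' < m * r" using False x u' by auto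
        then have "u' < r" using lm by simp
        then have "f u' \<le> m ^ N" using r u' by blast
        then have "f u' \<le> (1 - m) / 2 * c" using N by linarith
        moreover have "l * f u' \<le> f u'" using f01[OF u'(1)] lm by (intro mult_left_le_one_le) auto
        ultimately show ?thesis using ge0[OF u(1), folded u(2)] u'(3) p(3) cS
          unfolding right_diff_distrib by linarith
      qed
    qed
  qed
  then show ?case using d r lm by (intro exI[of _ "min (l * d) (m * r)"]) auto
qed

lemma f_continuous: "continuous_on {0..1} f"
  unfolding continuous_on_iff
proof (intro ballI allI impI)
  fix x e :: real assume x: "x \<in> {0..1}" and e: "e > 0"
  obtain n where n: "((1 + m) / 2) ^ n < e" using real_arch_pow_inv[OF e, of "(1 + m) / 2"] lm by auto
  obtain d where d: "d > 0"
    "\<And>x x'. x \<in> {0..1} \<Longrightarrow> x' \<in> {0..1} \<Longrightarrow> x \<le> x' \<Longrightarrow> x' < x + d \<Longrightarrow> f x' - f x \<le> ((1 + m) / 2) ^ n"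
    using modulus_approx by blast
  have "dist (f x') (f x) < e" if "x' \<in> {0..1}" "dist x' x < d" for x'
    using d(2)[of x x'] d(2)[of x' x] f_mono[of x x'] f_mono[of x' x] that x n
    by (cases "x \<le> x'") (auto simp: dist_real_def)
  then show "\<exists>d>0. \<forall>x'\<in>{0..1}. dist x' x < d \<longrightarrow> dist (f x') (f x) < e" using d(1) by blast
qed

section \<open>Strict monotonicity of the top function\<close>

text \<open>The first branch never exceeds \<open>m < 1\<close>, so a point with value 1 comes from
  the second branch. Its preimage again has value 1 and is farther from 1 by the factor
  \<open>1 / m\<close>; iteration leaves the unit interval.\<close>

lemma f_less_1: "f t < 1" if t: "t \<in> {0..1}" "t < 1"
proof (rule ccontr)
  assume "\<not> f t < 1"
  then have ft: "f t = 1" using f01 that by force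
  have "\<exists>s\<in>{0..1}. f s = 1 \<and> 1 - t \<le> m ^ n * (1 - s)" for n
  proof (induction n)
    case 0
    show ?case using that ft by auto
  next
    case (Suc n)
    then obtain s where s: "s \<in> {0..1}" "f s = 1" "1 - t \<le> m ^ n * (1 - s)" by blast
    from branches[OF s(1)] show ?case
    proof (elim disjE bexE conjE)
      fix u assume u: "u \<in> {0..1}" "f s = m * f u"
      have "m * f u \<le> m" using f01[OF u(1)] lm by simp
      then have False using u s lm by linarith
      then show ?thesis ..
    next
      fix u assume u: "u \<in> {0..1}" "s = m * u + 1 - m" "f s = l * f u + 1 - l"
      have "f u = 1" using u s lm by simp
      moreover have "1 - s = m * (1 - u)" using u by (simp add: algebra_simps)
      ultimately show ?thesis using u s by (intro bexI[of _ u]) (auto simp: mult.assoc mult.left_commute)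
    qed
  qed
  then obtain s where s: "\<And>n. s n \<in> {0..1}" "\<And>n. 1 - t \<le> m ^ n * (1 - s n)" by metis
  have "1 - t \<le> m ^ n" for n
    by (rule order_trans[OF s(2)[of n]]) (use s(1)[of n] lm in \<open>simp add: mult_left_le\<close>)
  moreover obtain n where "m ^ n < 1 - t" using real_arch_pow_inv[of "1 - t" m] t lm by auto
  ultimately show False by (simp add: not_le[symmetric])
qed

lemma plateau_expands:
  assumes x: "x \<in> {0..1}" "x' \<in> {0..1}" "x < x'" "f x = f x'"
  obtains u u' where "u \<in> {0..1}" "u' \<in> {0..1}" "u < u'" "f u = f u'" "x' - x \<le> m * (u' - u)"
proof -
  note result = that
  \<comment> \<open>The preimage \<open>u\<close> is left general because the case is needed twice,
    the second time at the point \<open>l\<close>, which both branches reach.\<close>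
  have branch1_case: thesis
    if u: "u \<in> {0..1}" "x = m * u + 1 - m" "f x = l * f u + 1 - l" for u
  proof -
    have "1 - m \<le> x" using u lm by simp
    then obtain u' where u': "u' \<in> {0..1}" "x' = m * u' + 1 - m"
      using ex_branch1[of x'] x by auto
    have "u < u'" using u u' x lm by simp
    moreover have "l * f u' \<le> l * f u" using ge1[OF u'(1)] u u' x by simp
    then have "f u' \<le> f u" using lm by simp
    then have "f u = f u'" using f_mono u u' \<open>u < u'\<close> by force
    ultimately show thesis using result u u' by (simp add: algebra_simps)
  qed
  from branches[OF x(1)] show thesis
  proof (elim disjE bexE conjE)
    fix u assume u: "u \<in> {0..1}" "x = l * u" "f x = m * f u"
    show thesis
    proof (cases "x' \<le> l")
      case True
      then obtain u' where u': "u' \<in> {0..1}" "x' = l * u'" using ex_branch0[of x'] x by auto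
      have less: "u < u'" using u u' x lm by simp
      have "m * f u' \<le> m * f u" using ge0[OF u'(1)] u u' x by simp
      then have "f u' \<le> f u" using lm by simp
      then have "f u = f u'" using f_mono u u' less by force
      moreover have "l * (u' - u) \<le> m * (u' - u)" using lm less by simp
      ultimately show thesis using result u u' less by (simp add: algebra_simps)
    next
      case False
      \<comment> \<open>A plateau starting on the first branch and passing \<open>l\<close> has
        height at least \<open>m\<close>, which forces \<open>f u = 1\<close>, hence
        \<open>u = 1\<close> and \<open>x = l\<close>. At \<open>l\<close> both branches then agree,
        so the plateau is treated as one of the second branch.\<close>
      obtain p where p: "p \<in> {0..1}" "l = m * p + 1 - m" "m \<le> l * f p + 1 - l"
        using right_end by blast
      have fl: "m \<le> f l" "l * f p + 1 - l \<le> f l" using ge1[OF p(1)] p by auto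
      have "f l \<le> f x'" using False x lm by (intro f_mono) auto
      with fl u x have "m \<le> m * f u" by simp
      then have "1 \<le> f u" using lm by simp
      then have "u = 1" using f_less_1 u by force
      then have "x = m * p + 1 - m" "f x = l * f p + 1 - l"
        using u p f1 fl \<open>f l \<le> f x'\<close> x by auto
      then show thesis using branch1_case p by blast
    qed
  next
    fix u assume "u \<in> {0..1}" "x = m * u + 1 - m" "f x = l * f u + 1 - l"
    then show thesis by (rule branch1_case)
  qed
qed

lemma f_strict_mono: "strict_mono_on {0..1} f"
proof (rule strict_mono_onI, rule ccontr)
  fix x x' :: real
  assume x: "x \<in> {0..1}" "x' \<in> {0..1}" "x < x'" "\<not> f x < f x'"
  have eq: "f x = f x'" using f_mono x by force
  have "\<exists>u\<in>{0..1}. \<exists>u'\<in>{0..1}. u < u' \<and> f u = f u' \<and> x' - x \<le> m ^ n * (u' - u)" for n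
  proof (induction n)
    case 0
    show ?case using x eq by (intro bexI[of _ x] bexI[of _ x']) auto
  next
    case (Suc n)
    then obtain u u' where u: "u \<in> {0..1}" "u' \<in> {0..1}" "u < u'" "f u = f u'"
      "x' - x \<le> m ^ n * (u' - u)" by blast
    from plateau_expands[OF u(1-4)] obtain v v' where v: "v \<in> {0..1}" "v' \<in> {0..1}" "v < v'"
      "f v = f v'" "u' - u \<le> m * (v' - v)" by blast
    have "m ^ n * (u' - u) \<le> m ^ n * (m * (v' - v))" using v lm by (intro mult_left_mono) auto
    then have "x' - x \<le> m ^ Suc n * (v' - v)" using u by (simp add: mult.assoc mult.left_commute)
    then show ?case using v by blast
  qed
  then obtain u u' where u: "\<And>n. u n \<in> {0..1}" "\<And>n. u' n \<in> {0..1}"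
      "\<And>n. x' - x \<le> m ^ n * (u' n - u n)" by metis
  have "x' - x \<le> m ^ n" for n
    by (rule order_trans[OF u(3)[of n]]) (use u(1,2)[of n] lm in \<open>simp add: mult_left_le\<close>)
  moreover obtain n where "m ^ n < x' - x" using real_arch_pow_inv[of "x' - x" m] x lm by auto
  ultimately show False by (simp add: not_le[symmetric])
qed

end

section \<open>The affine maps and the attractor A\<close>

abbreviation unit_square :: "(real \<times> real) set" where
  "unit_square \<equiv> {0..1} \<times> {0..1}"

text \<open>The fixed points of \<open>T0\<close> and \<open>T1\<close>, which are also the default
  values of \<open>S0\<close> and \<open>S1\<close>.\<close>

abbreviation corners :: "(real \<times> real) set" where
  "corners \<equiv> {(0, 0), (1, 1)}"

context
  fixes l m :: real
  assumes lm: "0 < l" "l < m" "m < 1" "1 < l + m"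
begin

lemma T0_alt: "T0 l m p = (l * fst p, m * snd p)"
  by (cases p) simp

lemma T1_alt: "T1 l m p = (m * fst p + 1 - m, l * snd p + 1 - l)"
  by (cases p) simp

lemma S0_alt: "S0 l m p = (if l * fst p + m * snd p \<le> 1 then T0 l m p else (0, 0))"
  by (cases p) simp

lemma S1_alt: "S1 l m p = (if l + m - 1 \<le> m * fst p + l * snd p then T1 l m p else (1, 1))"
  by (cases p) simp

text \<open>The distance on pairs is Euclidean, so scaling the axes by factors of at most
  \<open>m\<close> scales it by at most \<open>m\<close>. The two orders of the factors serve
  \<open>T0\<close> and \<open>T1\<close>.\<close>

lemma dist_scale_le:
  fixes a b :: real
  assumes "0 \<le> a" "a \<le> m" "0 \<le> b" "b \<le> m"
  shows "sqrt ((a * s)\<^sup>2 + (b * t)\<^sup>2) \<le> m * sqrt (s\<^sup>2 + t\<^sup>2)"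
proof -
  have "a\<^sup>2 * s\<^sup>2 \<le> m\<^sup>2 * s\<^sup>2" "b\<^sup>2 * t\<^sup>2 \<le> m\<^sup>2 * t\<^sup>2"
    using assms by (auto intro!: mult_right_mono power_mono)
  then have "(a * s)\<^sup>2 + (b * t)\<^sup>2 \<le> m\<^sup>2 * (s\<^sup>2 + t\<^sup>2)"
    by (simp add: power_mult_distrib algebra_simps)
  then have "sqrt ((a * s)\<^sup>2 + (b * t)\<^sup>2) \<le> sqrt (m\<^sup>2 * (s\<^sup>2 + t\<^sup>2))" by (rule real_sqrt_le_mono)
  also have "\<dots> = m * sqrt (s\<^sup>2 + t\<^sup>2)" using lm by (simp add: real_sqrt_mult)
  finally show ?thesis .
qed

lemma lipschitz_T: "m-lipschitz_on UNIV (T0 l m)" "m-lipschitz_on UNIV (T1 l m)"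
proof -
  show "m-lipschitz_on UNIV (T0 l m)"
  proof (rule lipschitz_onI)
    fix p q
    show "dist (T0 l m p) (T0 l m q) \<le> m * dist p q"
      using dist_scale_le[of l m "dist (fst p) (fst q)" "dist (snd p) (snd q)"] lm
      by (simp add: T0_alt dist_prod_def dist_real_def power_mult_distrib flip: right_diff_distrib)
  qed (use lm in simp)
  show "m-lipschitz_on UNIV (T1 l m)"
  proof (rule lipschitz_onI)
    fix p q
    show "dist (T1 l m p) (T1 l m q) \<le> m * dist p q"
      using dist_scale_le[of m l "dist (fst p) (fst q)" "dist (snd p) (snd q)"] lm
      by (simp add: T1_alt dist_prod_def dist_real_def power_mult_distrib flip: right_diff_distrib)
  qed (use lm in simp)
qed

lemma continuous_T: "continuous_on K (T0 l m)" "continuous_on K (T1 l m)"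
  unfolding T0_alt T1_alt by (intro continuous_intros)+

lemma T_unit_square: "T0 l m ` unit_square \<union> T1 l m ` unit_square \<subseteq> unit_square"
proof -
  have "m * t + 1 - m \<in> {0..1}" "l * t + 1 - l \<in> {0..1}" "l * t \<in> {0..1}" "m * t \<in> {0..1}"
    if "t \<in> {0..1}" for t
  proof -
    have "m * t \<le> m" "l * t \<le> l" "0 \<le> m * t" "0 \<le> l * t"
      using that lm by (auto simp: mult_left_le)
    then show "m * t + 1 - m \<in> {0..1}" "l * t + 1 - l \<in> {0..1}" "l * t \<in> {0..1}" "m * t \<in> {0..1}"
      using lm unfolding atLeastAtMost_iff by linarith+
  qed
  then show ?thesis by (auto simp: T0_alt T1_alt)
qed

lemma T_corners: "corners \<subseteq> T0 l m ` corners \<union> T1 l m ` corners"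
  by auto

text \<open>One inclusion suffices, as the hypotheses are symmetric. Uniqueness justifies the
  definite description in \<open>attractor_A\<close>.\<close>

lemma attractor_T_unique:
  assumes "is_attractor (T0 l m) (T1 l m) K" "is_attractor (T0 l m) (T1 l m) L"
  shows "K \<subseteq> L"
  by (rule sub_self_image_subset_invariant[OF lipschitz_T lm(3)
        is_attractorD(2,5)[OF assms(1)] is_attractorD(3,1,6)[OF assms(2)]])

lemma attractor_A: "is_attractor (T0 l m) (T1 l m) (attractor_A l m)"
proof -
  have "closed (T0 l m ` K \<union> T1 l m ` K)" if "compact K" for K
    using that by (intro closed_Un compact_imp_closed compact_continuous_image continuous_T)
  moreover have "compact unit_square" "corners \<subseteq> unit_square" by (auto intro: compact_Times)
  ultimately obtain K where K: "is_attractor (T0 l m) (T1 l m) K"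
    using greatest_attractor_exists[OF _ T_unit_square insert_not_empty _ T_corners] by metis
  show ?thesis unfolding attractor_A_def
    using K by (rule theI[where P = "is_attractor (T0 l m) (T1 l m)"])
      (use K attractor_T_unique in blast)
qed

lemma sub_self_image_subset_A:
  assumes "bounded K" "K \<subseteq> T0 l m ` K \<union> T1 l m ` K"
  shows "K \<subseteq> attractor_A l m"
  by (rule sub_self_image_subset_invariant[OF lipschitz_T lm(3) assms
        is_attractorD(3,1,6)[OF attractor_A]])

lemma corners_A: "corners \<subseteq> attractor_A l m"
  by (rule sub_self_image_subset_A) auto

text \<open>Stated for sets merely covered by their image, so that it also applies to attractors of
  \<open>S0\<close>, \<open>S1\<close> enlarged by the corners.\<close>

lemma sub_self_image_subset_unit_square:
  assumes "bounded K" "K \<subseteq> T0 l m ` K \<union> T1 l m ` K"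
  shows "K \<subseteq> unit_square"
  by (rule sub_self_image_subset_invariant[OF lipschitz_T lm(3) assms _ _ T_unit_square])
    (auto intro: closed_Times)

lemma A_unit_square: "attractor_A l m \<subseteq> unit_square"
  by (rule sub_self_image_subset_unit_square[OF is_attractorD(2,5)[OF attractor_A]])

text \<open>The first coordinates of \<open>T0\<close> and \<open>T1\<close> are contractions of the
  line whose images of the unit interval cover it, because \<open>1 - m < l\<close>. The projection
  of the attractor is closed and invariant under them, so it contains the interval.\<close>

lemma fst_A: "fst ` attractor_A l m = {0..1}"
proof
  show "fst ` attractor_A l m \<subseteq> {0..1}" using A_unit_square by force
  let ?f = "\<lambda>x. l * x" and ?g = "\<lambda>x. m * x + 1 - m"
  note A = is_attractorD[OF attractor_A]
  show "{0..1} \<subseteq> fst ` attractor_A l m"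
  proof (rule sub_self_image_subset_invariant[of m ?f ?g])
    show "m-lipschitz_on UNIV ?f" "m-lipschitz_on UNIV ?g"
      using lm by (auto intro!: lipschitz_onI mult_right_mono
          simp: dist_real_def abs_mult simp flip: right_diff_distrib)
    show "{0..1} \<subseteq> ?f ` {0..1} \<union> ?g ` {0..1}"
    proof
      fix x :: real assume x: "x \<in> {0..1}"
      show "x \<in> ?f ` {0..1} \<union> ?g ` {0..1}"
      proof (cases "x \<le> l")
        case True
        then show ?thesis using x lm by (intro UnI1 image_eqI[of _ _ "x / l"]) auto
      next
        case False
        then show ?thesis using x lm
          by (intro UnI2 image_eqI[of _ _ "(x - 1 + m) / m"]) (auto simp: field_simps)
      qed
    qed
    show "closed (fst ` attractor_A l m)"
      using A(4) by (intro compact_imp_closed compact_continuous_image continuous_intros)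
    have "?f (fst p) = fst (T0 l m p)" "?g (fst p) = fst (T1 l m p)" for p
      by (auto simp: T0_alt T1_alt)
    then show "?f ` fst ` attractor_A l m \<union> ?g ` fst ` attractor_A l m \<subseteq> fst ` attractor_A l m"
      using A(6) by force
  qed (use A(1) lm in auto)
qed

section \<open>The truncated maps and the attractor B\<close>

lemma S_image_subset: "S0 l m ` K \<union> S1 l m ` K \<subseteq> T0 l m ` K \<union> T1 l m ` K \<union> corners"
  by (auto simp: S0_alt S1_alt simp del: S0.simps S1.simps T0.simps T1.simps)

text \<open>Adding the corners absorbs the default values of \<open>S0\<close> and
  \<open>S1\<close>. The contraction argument for \<open>T0\<close> and \<open>T1\<close> thereby
  applies to the discontinuous system.\<close>

lemma sub_S_image_corners:
  assumes "K \<subseteq> S0 l m ` K \<union> S1 l m ` K"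
  shows "K \<union> corners \<subseteq> T0 l m ` (K \<union> corners) \<union> T1 l m ` (K \<union> corners)"
  using assms S_image_subset[of K] T_corners by blast

text \<open>If \<open>K\<close> contains the corner to which the discarded points are sent, then discarding
  them altogether does not change the image, and the discarded part is relatively open.\<close>

lemma S0_image: "S0 l m ` K = T0 l m ` (K \<inter> {p. l * fst p + m * snd p \<le> 1})" if "corners \<subseteq> K"
proof -
  have "(0, 0) = T0 l m (0, 0)" "(0, 0) \<in> K \<inter> {p. l * fst p + m * snd p \<le> 1}" using that by auto
  then have "(0, 0) \<in> T0 l m ` (K \<inter> {p. l * fst p + m * snd p \<le> 1})" by (rule image_eqI)
  then show ?thesis by (auto simp: S0_alt simp del: S0.simps T0.simps)
qed

lemma S1_image: "S1 l m ` K = T1 l m ` (K \<inter> {p. l + m - 1 \<le> m * fst p + l * snd p})"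
  if "corners \<subseteq> K"
proof -
  have "(1, 1) = T1 l m (1, 1)" "(1, 1) \<in> K \<inter> {p. l + m - 1 \<le> m * fst p + l * snd p}"
    using that by auto
  then have "(1, 1) \<in> T1 l m ` (K \<inter> {p. l + m - 1 \<le> m * fst p + l * snd p})" by (rule image_eqI)
  then show ?thesis by (auto simp: S1_alt simp del: S1.simps T1.simps)
qed

text \<open>With the corners as seed, images have to be closed only for compact sets containing
  them, where \<open>S0\<close> and \<open>S1\<close> act as continuous maps on closed
  parts.\<close>

lemma attractor_B: "is_attractor (S0 l m) (S1 l m) (attractor_B l m)"
proof -
  have "closed (S0 l m ` K \<union> S1 l m ` K)" if "compact K" "corners \<subseteq> K" for K
    unfolding S0_image[OF that(2)] S1_image[OF that(2)] using that(1)
    by (intro closed_Un compact_imp_closed compact_continuous_image continuous_T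
        compact_Int_closed closed_Collect_le continuous_intros)
  moreover have "S0 l m ` unit_square \<union> S1 l m ` unit_square \<subseteq> unit_square"
    by (rule order_trans[OF S_image_subset Un_least[OF T_unit_square]]) auto
  moreover have "corners \<subseteq> S0 l m ` corners \<union> S1 l m ` corners"
    by (simp add: S0_image S1_image)
  moreover have "compact unit_square" "corners \<subseteq> unit_square" by (auto intro: compact_Times)
  ultimately obtain K where K: "is_attractor (S0 l m) (S1 l m) K"
    "\<And>L. L \<subseteq> unit_square \<Longrightarrow> L \<subseteq> S0 l m ` L \<union> S1 l m ` L \<Longrightarrow> L \<subseteq> K"
    using greatest_attractor_exists[of unit_square "S0 l m" "S1 l m" corners] insert_not_empty by metis
  \<comment> \<open>\<open>K\<close> is greatest only among subsets of the unit square, so an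
    arbitrary attractor must first be shown to lie in it.\<close>
  have "L \<subseteq> K" if "is_attractor (S0 l m) (S1 l m) L" for L
  proof (rule K(2))
    note L = is_attractorD[OF that]
    have "L \<union> corners \<subseteq> unit_square"
      by (rule sub_self_image_subset_unit_square[OF _ sub_S_image_corners[OF L(5)]])
        (use L(2) in simp)
    then show "L \<subseteq> unit_square" by blast
    show "L \<subseteq> S0 l m ` L \<union> S1 l m ` L" by (rule L(5))
  qed
  then show ?thesis unfolding attractor_B_def using K(1) by (blast intro: GreatestI2_order)
qed

lemma B_subset_A: "attractor_B l m \<subseteq> attractor_A l m"
proof -
  note B = is_attractorD[OF attractor_B]
  have "attractor_B l m \<union> corners \<subseteq> attractor_A l m"
    by (rule sub_self_image_subset_A[OF _ sub_S_image_corners[OF B(5)]]) (use B(2) in simp)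
  then show ?thesis by blast
qed

text \<open>\<open>S\<^sub>0\<close> only reaches points on or below the antidiagonal \<open>x + y = 1\<close>, and \<open>S\<^sub>1\<close> only
  points on or above it.\<close>

lemma B_above_antidiagonal:
  assumes "(x, y) \<in> attractor_B l m" "1 < x + y"
  shows "(x, y) \<in> T1 l m ` attractor_A l m"
proof -
  obtain p where p: "p \<in> attractor_B l m" "(x, y) = S0 l m p \<or> (x, y) = S1 l m p"
    using assms(1) is_attractorD(5)[OF attractor_B] by blast
  have "\<not> (x, y) = S0 l m p" using assms(2) by (auto simp: S0_alt T0_alt)
  moreover have "(1, 1) \<in> T1 l m ` attractor_A l m"
    using corners_A by (intro image_eqI[of _ _ "(1, 1)"]) auto
  moreover have "p \<in> attractor_A l m" using p(1) B_subset_A by blast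
  ultimately show ?thesis using p(2) by (auto simp: S1_alt split: if_splits)
qed

lemma B_below_antidiagonal:
  assumes "(x, y) \<in> attractor_B l m" "x + y < 1"
  shows "(x, y) \<in> T0 l m ` attractor_A l m"
proof -
  obtain p where p: "p \<in> attractor_B l m" "(x, y) = S0 l m p \<or> (x, y) = S1 l m p"
    using assms(1) is_attractorD(5)[OF attractor_B] by blast
  have "\<not> (x, y) = S1 l m p" using assms(2) by (auto simp: S1_alt T1_alt)
  moreover have "(0, 0) \<in> T0 l m ` attractor_A l m"
    using corners_A by (intro image_eqI[of _ _ "(0, 0)"]) auto
  moreover have "p \<in> attractor_A l m" using p(1) B_subset_A by blast
  ultimately show ?thesis using p(2) by (auto simp: S0_alt split: if_splits)
qed

section \<open>From membership in G to the top function\<close>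

text \<open>Self-similarity of the attractor yields the functional equation; the two
  \<open>below\<close> assumptions enter only in the last two goals, \<open>right_end\<close> and
  \<open>left_end\<close>.\<close>

lemma top_functionI:
  assumes below: "is_below (T0 l m (1, 1)) (attractor_B l m)" "is_below (T1 l m (0, 0)) (attractor_B l m)"
    and top: "\<And>x. x \<in> {0..1} \<Longrightarrow> (x, f x) \<in> attractor_A l m"
      "\<And>x y. (x, y) \<in> attractor_A l m \<Longrightarrow> y \<le> f x"
  shows "top_function l m f"
proof
  let ?A = "attractor_A l m"
  note A = is_attractorD(5,6)[OF attractor_A]
  have A0: "(l * x, m * y) \<in> ?A" and A1: "(m * x + 1 - m, l * y + 1 - l) \<in> ?A"
    if "(x, y) \<in> ?A" for x y
  proof -
    have "T0 l m (x, y) \<in> ?A" "T1 l m (x, y) \<in> ?A" using A(2) that by blast+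
    then show "(l * x, m * y) \<in> ?A" "(m * x + 1 - m, l * y + 1 - l) \<in> ?A" by simp_all
  qed
  show f01: "f x \<in> {0..1}" if "x \<in> {0..1}" for x
    using top(1)[OF that] A_unit_square by auto
  show ge0: "m * f x \<le> f (l * x)" if "x \<in> {0..1}" for x
    using top(2)[OF A0[OF top(1)[OF that]]] .
  show ge1: "l * f x + 1 - l \<le> f (m * x + 1 - m)" if "x \<in> {0..1}" for x
    using top(2)[OF A1[OF top(1)[OF that]]] .
  show br: "(\<exists>u\<in>{0..1}. x = l * u \<and> f x = m * f u) \<or>
        (\<exists>u\<in>{0..1}. x = m * u + 1 - m \<and> f x = l * f u + 1 - l)" if "x \<in> {0..1}" for x
  proof -
    have "(x, f x) \<in> T0 l m ` ?A \<union> T1 l m ` ?A" using top(1)[OF that] A(1) by blast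
    then consider u v where "(u, v) \<in> ?A" "x = l * u" "f x = m * v"
      | u v where "(u, v) \<in> ?A" "x = m * u + 1 - m" "f x = l * v + 1 - l"
      by auto
    then show ?thesis
    proof cases
      case (1 u v)
      have u: "u \<in> {0..1}" using 1(1) A_unit_square by auto
      have "m * v \<le> m * f u" using top(2)[OF 1(1)] lm by simp
      with ge0[OF u] 1 u show ?thesis by force
    next
      case (2 u v)
      have u: "u \<in> {0..1}" using 2(1) A_unit_square by auto
      have "l * v \<le> l * f u" using top(2)[OF 2(1)] lm by simp
      with ge1[OF u] 2 u show ?thesis by force
    qed
  qed
  show f0: "f 0 = 0"
  proof -
    \<comment> \<open>Only the first branch reaches 0, and only from \<open>u = 0\<close>, so
      \<open>f 0 = m * f 0\<close>.\<close>
    have "m * u + 1 - m > 0" if "u \<in> {0..1}" for u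
    proof -
      have "0 \<le> m * u" using that lm by simp
      then show ?thesis using lm by linarith
    qed
    then show ?thesis using br[of 0] lm by fastforce
  qed
  show "f 1 = 1"
    using top(2)[of 1 1] f01[of 1] corners_A by fastforce
  show "\<exists>u\<in>{0..1}. l = m * u + 1 - m \<and> m \<le> l * f u + 1 - l"
  proof -
    obtain y where y: "m \<le> y" "(l, y) \<in> attractor_B l m" using below(1) by auto
    then have "(l, y) \<in> T1 l m ` ?A" using lm by (intro B_above_antidiagonal) auto
    then obtain u v where u: "(u, v) \<in> ?A" "l = m * u + 1 - m" "y = l * v + 1 - l" by auto
    have "l * v \<le> l * f u" using top(2)[OF u(1)] lm by simp
    moreover have "u \<in> {0..1}" using u(1) A_unit_square by auto
    ultimately show ?thesis using u y by (intro bexI[of _ u]) auto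
  qed
  show "\<exists>u\<in>{0..1}. 1 - m = l * u \<and> 1 - l \<le> m * f u"
  proof -
    obtain y where y: "1 - l \<le> y" "(1 - m, y) \<in> attractor_B l m" using below(2) by auto
    \<comment> \<open>The point need not lie below the antidiagonal, as \<open>y\<close> may be
      large. Were it outside the image of \<open>T0\<close>, it would come under \<open>T1\<close>
      from a point over 0, of height at most \<open>f 0 = 0\<close>; then \<open>y\<close> is at
      most \<open>1 - l\<close> and the point does lie below.\<close>
    have "(1 - m, y) \<in> T0 l m ` ?A"
    proof (rule ccontr)
      assume notin: "(1 - m, y) \<notin> T0 l m ` ?A"
      then have "(1 - m, y) \<in> T1 l m ` ?A" using y(2) B_subset_A A(1) by blast
      then obtain v where v: "(0, v) \<in> ?A" "y = l * v + 1 - l" using lm by auto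
      have "v \<le> 0" using top(2)[OF v(1)] f0 by simp
      then have "l * v \<le> 0" using lm by (simp add: mult_nonneg_nonpos)
      then have "1 - m + y < 1" using v lm by simp
      then show False using B_below_antidiagonal[OF y(2)] notin by simp
    qed
    then obtain u v where u: "(u, v) \<in> ?A" "1 - m = l * u" "y = m * v" by auto
    have "m * v \<le> m * f u" using top(2)[OF u(1)] lm by simp
    moreover have "u \<in> {0..1}" using u(1) A_unit_square by auto
    ultimately show ?thesis using u y by (intro bexI[of _ u]) auto
  qed
qed (use lm in auto)

text \<open>Vertical slices of the attractor are compact, and nonempty by
  \<open>fst_A\<close>.\<close>

lemma ex_top:
  assumes "x \<in> {0..1}"
  shows "\<exists>y. (x, y) \<in> attractor_A l m \<and> (\<forall>y'. (x, y') \<in> attractor_A l m \<longrightarrow> y' \<le> y)"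
proof -
  let ?C = "attractor_A l m \<inter> {p. fst p = x}"
  have "closed {p :: real \<times> real. fst p = x}" by (intro closed_Collect_eq continuous_intros)
  then have "compact ?C" using is_attractorD(4)[OF attractor_A] by (rule compact_Int_closed[rotated])
  moreover have "?C \<noteq> {}" using assms fst_A by force
  moreover have "continuous_on ?C snd" by (intro continuous_intros)
  ultimately obtain p where "p \<in> ?C" "\<forall>q\<in>?C. snd q \<le> snd p" by (metis continuous_attains_sup)
  then show ?thesis by (cases p) force
qed

end

theorem theorem1p1:
  fixes l m :: real
  assumes "(l, m) \<in> G"
  shows "\<exists>f :: real \<Rightarrow> real.
           continuous_on {0..1} f \<and> strict_mono_on {0..1} f \<and>
           top_boundary (attractor_A l m) = {(x, f x) | x. x \<in> {0..1}}"
proof -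
  have lm: "0 < l" "l < m" "m < 1" "1 < l + m"
    and below: "is_below (T0 l m (1, 1)) (attractor_B l m)" "is_below (T1 l m (0, 0)) (attractor_B l m)"
    using assms unfolding G_def by blast+
  obtain f where f: "\<And>x. x \<in> {0..1} \<Longrightarrow> (x, f x) \<in> attractor_A l m"
    "\<And>x y. x \<in> {0..1} \<Longrightarrow> (x, y) \<in> attractor_A l m \<Longrightarrow> y \<le> f x"
    using ex_top[OF lm] by metis
  have dom: "x \<in> {0..1}" if "(x, y) \<in> attractor_A l m" for x y
    using that A_unit_square[OF lm] by auto
  interpret top_function l m f
    using top_functionI[OF lm below f(1)] f(2) dom by blast
  have "(x, y) \<in> top_boundary (attractor_A l m) \<longleftrightarrow> x \<in> {0..1} \<and> y = f x" for x y
    unfolding top_boundary_def using f dom by (blast intro: order_antisym)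
  then have "top_boundary (attractor_A l m) = {(x, f x) | x. x \<in> {0..1}}" by auto
  then show ?thesis using f_continuous f_strict_mono by blast
qed

end
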